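(* (1) $M_\infty$ is a subgroup of $\mathrm{Aut}(T_\infty)$. (2) For every $n\ge1$, $M_n$ is a subgroup of $\mathrm{Aut}(T_n)$. (3) The map $P:M_\infty\to\mathbb{Z}_2^\times$, $\sigma\mapsto P(\sigma)$, is a group homomorphism. (4) For every $n\ge1$, the map $P:M_n\to(\mathbb{Z}/2^j\mathbb{Z})^\times$, where $j:=\lfloor(n+1)/2\rfloor$, is a group homomorphism.
   Context: $T_\infty$ is the infinite binary rooted tree whose nodes at level $m\ge0$ are the words of length $m$ over $\{a,b\}$ (root $x_0$ = empty word), with each node $w$ joined to $wa$ and $wb$; $T_n$ is the subtree of words of length $\le n$. $\mathrm{Aut}(T_\infty)$, $\mathrm{Aut}(T_n)$ are the groups of root-preserving tree automorphisms; such $\sigma$ maps $\{xa,xb\}$ onto $\{\sigma(x)a,\sigma(x)b\}$. Define $\mathrm{Par}(\sigma,x)=0$ if $\sigma(xa)=\sigma(x)a$ and $\sigma(xb)=\sigma(x)b$, and $=1$ if $\sigma(xa)=\sigma(x)b$ and $\sigma(xb)=\sigma(x)a$. For $\sigma\in\mathrm{Aut}(T_\infty)$ and a node $x$: $Q(\sigma,x):=\sum_{i\ge0}2^i\sum_{s_1,\ldots,s_i\in\{a,b\}}\mathrm{Par}(\sigma,x\,a\,s_1\,a\,s_2\cdots a\,s_i)\in\mathbb{Z}_2$ (concatenated words; the $i=0$ term is $\mathrm{Par}(\sigma,x)$), and $P(\sigma,x):=(-1)^{\mathrm{Par}(\sigma,x)}+2\sum_{t\in\{a,b\}}Q(\sigma,xbt)-2\sum_{t\in\{a,b\}}Q(\sigma,xat)\in\mathbb{Z}_2^\times$.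 For $n\ge m\ge0$, a node $x$ of length $m$ and $\tau\in\mathrm{Aut}(T_n)$, with $j:=\lfloor(n-m+1)/2\rfloor$, $P(\tau,x)\in(\mathbb{Z}/2^j\mathbb{Z})^\times$ is $P(\tilde\tau,x)\bmod 2^j$ for any extension $\tilde\tau\in\mathrm{Aut}(T_\infty)$ of $\tau$ (this is independent of the extension). $M_\infty:=\{\sigma\in\mathrm{Aut}(T_\infty): P(\sigma,x)=P(\sigma,x_0)\text{ for every node }x\}$, and for $\sigma\in M_\infty$, $P(\sigma):=P(\sigma,x_0)$. For $n\ge1$, $M_n:=\{\sigma\in\mathrm{Aut}(T_n):$ for every $m\ge0$ and every word $x$ of length $m$, $P(\sigma,x)\equiv P(\sigma,x_0)\pmod{2^{\lfloor(n-m+1)/2\rfloor}}\}$, and for $\sigma\in M_n$, $P(\sigma):=P(\sigma,x_0)\in(\mathbb{Z}/2^{\lfloor(n+1)/2\rfloor}\mathbb{Z})^\times$. *)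

theory Defs
  imports
    Complex_Main
    "HOL-Library.Extended_Nat"
    "HOL-Algebra.Bij"
    "HOL-Number_Theory.Residues"
begin

section \<open>The ring of 2-adic integers\<close>

text \<open>
  The inverse limit of the rings Z/2^k: an element is a coherent sequence of residues, where the
  k-th entry is normalised to lie in {0..<2^k} (this range condition follows from coherence).
  Thus \<open>residue z k\<close> is the canonical representative of z modulo 2^k.
\<close>

typedef two_adic = "{f :: nat \<Rightarrow> int. \<forall>k. f k = f (Suc k) mod 2 ^ k}"
  morphisms residue Abs_two_adic
  by (rule exI[of _ "\<lambda>_. 0"]) simp

setup_lifting type_definition_two_adic

lemma mod_pow_Suc: "(m :: int) mod 2 ^ Suc k mod 2 ^ k = m mod 2 ^ k"
  by (rule mod_mod_cancel) simp

instantiation two_adic :: comm_ring_1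
begin

lift_definition zero_two_adic :: two_adic is "\<lambda>_. 0" by simp

lift_definition one_two_adic :: two_adic is "\<lambda>k. 1 mod 2 ^ k"
  by (simp only: mod_pow_Suc simp_thms)

lift_definition plus_two_adic :: "two_adic \<Rightarrow> two_adic \<Rightarrow> two_adic"
  is "\<lambda>f g k. (f k + g k) mod 2 ^ k"
  by (metis mod_pow_Suc mod_add_eq)

lift_definition uminus_two_adic :: "two_adic \<Rightarrow> two_adic"
  is "\<lambda>f k. (- f k) mod 2 ^ k"
  by (metis mod_pow_Suc mod_minus_eq)

lift_definition minus_two_adic :: "two_adic \<Rightarrow> two_adic \<Rightarrow> two_adic"
  is "\<lambda>f g k. (f k - g k) mod 2 ^ k"
  by (metis mod_pow_Suc mod_diff_eq)

lift_definition times_two_adic :: "two_adic \<Rightarrow> two_adic \<Rightarrow> two_adic"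
  is "\<lambda>f g k. (f k * g k) mod 2 ^ k"
  by (metis mod_pow_Suc mod_mult_eq)

lemmas residue_simps =
  zero_two_adic.rep_eq one_two_adic.rep_eq plus_two_adic.rep_eq
  uminus_two_adic.rep_eq minus_two_adic.rep_eq times_two_adic.rep_eq

instance
proof
  fix a b c :: two_adic
  have r: "residue x k mod 2 ^ k = residue x k" for x k
    using residue[of x] by (metis (mono_tags, lifting) mem_Collect_eq mod_mod_trivial)
  have r0: "residue x 0 = 0" for x
    using r[of x 0] by simp
  show "a * b * c = a * (b * c)"
    by (rule residue_inject[THEN iffD1]) (simp add: fun_eq_iff residue_simps mod_simps mult.assoc)
  show "a * b = b * a"
    by (rule residue_inject[THEN iffD1]) (simp add: fun_eq_iff residue_simps mult.commute)
  show "1 * a = a"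
    by (rule residue_inject[THEN iffD1]) (simp add: fun_eq_iff residue_simps mod_simps r r0)
  show "a + b + c = a + (b + c)"
    by (rule residue_inject[THEN iffD1]) (simp add: fun_eq_iff residue_simps mod_simps add.assoc)
  show "a + b = b + a"
    by (rule residue_inject[THEN iffD1]) (simp add: fun_eq_iff residue_simps add.commute)
  show "0 + a = a"
    by (rule residue_inject[THEN iffD1]) (simp add: fun_eq_iff residue_simps r)
  show "- a + a = 0"
    by (rule residue_inject[THEN iffD1]) (simp add: fun_eq_iff residue_simps mod_simps)
  show "a - b = a + - b"
    by (rule residue_inject[THEN iffD1]) (simp add: fun_eq_iff residue_simps mod_simps)
  show "(a + b) * c = a * c + b * c"
    by (rule residue_inject[THEN iffD1])
      (simp add: fun_eq_iff residue_simps mod_simps distrib_right)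
  have "residue 0 1 \<noteq> residue 1 1" by (simp add: residue_simps)
  then show "(0 :: two_adic) \<noteq> 1" by metis
qed

end

text \<open>The 2-adic topology: the cosets of the ideals generated by 2^k form a basis.\<close>

instantiation two_adic :: t2_space
begin

definition open_two_adic :: "two_adic set \<Rightarrow> bool" where
  "open_two_adic U \<longleftrightarrow> (\<forall>x\<in>U. \<exists>k. \<forall>y. residue y k = residue x k \<longrightarrow> y \<in> U)"

lemma residue_mod: "k \<le> l \<Longrightarrow> residue x l mod 2 ^ k = residue x k"
proof (induction l rule: dec_induct)
  case base
  then show ?case
    using residue[of x] by (metis (mono_tags, lifting) mem_Collect_eq mod_mod_trivial)
next
  case (step l)
  have "residue x (Suc l) mod 2 ^ k = residue x (Suc l) mod 2 ^ l mod 2 ^ k"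
    by (rule mod_mod_cancel[symmetric]) (simp add: step.hyps le_imp_power_dvd)
  also have "residue x (Suc l) mod 2 ^ l = residue x l"
    using residue[of x] by (metis (mono_tags, lifting) mem_Collect_eq)
  finally show ?case using step.IH by simp
qed

lemma residue_eq_mono: "residue x l = residue y l \<Longrightarrow> k \<le> l \<Longrightarrow> residue x k = residue y k"
  by (metis residue_mod)

instance
proof
  show "open (UNIV :: two_adic set)"
    by (simp add: open_two_adic_def)
next
  fix S T :: "two_adic set"
  assume S: "open S" and T: "open T"
  show "open (S \<inter> T)"
    unfolding open_two_adic_def
  proof
    fix x assume x: "x \<in> S \<inter> T"
    obtain k l where "\<forall>y. residue y k = residue x k \<longrightarrow> y \<in> S"
      and "\<forall>y. residue y l = residue x l \<longrightarrow> y \<in> T"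
      using S T x unfolding open_two_adic_def by blast
    then have "\<forall>y. residue y (max k l) = residue x (max k l) \<longrightarrow> y \<in> S \<inter> T"
      by (meson IntI max.cobounded1 max.cobounded2 residue_eq_mono)
    then show "\<exists>k. \<forall>y. residue y k = residue x k \<longrightarrow> y \<in> S \<inter> T" ..
  qed
next
  fix K :: "two_adic set set"
  assume "\<forall>S\<in>K. open S"
  then show "open (\<Union>K)"
    unfolding open_two_adic_def by (meson UnionE UnionI)
next
  fix x y :: two_adic
  assume "x \<noteq> y"
  then obtain k where k: "residue x k \<noteq> residue y k"
    using residue_inject by blast
  have "open {z. residue z k = r}" for r
    by (auto simp: open_two_adic_def)
  then show "\<exists>U V. open U \<and> open V \<and> x \<in> U \<and> y \<in> V \<and> U \<inter> V = {}"
    using k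
    by (intro exI[of _ "{z. residue z k = residue x k}"] exI[of _ "{z. residue z k = residue y k}"])
      auto
qed

end

lemma residue_sum: "residue (sum f A) k = (\<Sum>i\<in>A. residue (f i) k) mod 2 ^ k"
  by (induction A rule: infinite_finite_induct)
    (simp_all add: zero_two_adic.rep_eq plus_two_adic.rep_eq mod_simps)

lemma residue_of_nat: "residue (of_nat m) k = int m mod 2 ^ k"
  by (induction m)
    (simp_all add: zero_two_adic.rep_eq plus_two_adic.rep_eq one_two_adic.rep_eq mod_simps)

lemma summable_two_adic: "summable (\<lambda>i. 2 ^ i * c i :: two_adic)"
proof -
  have term0: "residue (2 ^ i * c i) k = 0" if "k \<le> i" for i k
  proof -
    have "residue (2 ^ i :: two_adic) k = 2 ^ i mod 2 ^ k"
      using residue_of_nat[of "2 ^ i" k] by simp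
    also have "\<dots> = 0"
      using that by (simp add: le_imp_power_dvd)
    finally show ?thesis by (simp add: times_two_adic.rep_eq)
  qed
  define S where "S n = (\<Sum>i<n. 2 ^ i * c i)" for n
  have S: "residue (S n) k = residue (S k) k" if "k \<le> n" for n k
    using that
    by (induction n rule: dec_induct)
      (simp_all add: S_def plus_two_adic.rep_eq term0 residue_mod)
  define L where "L = Abs_two_adic (\<lambda>k. residue (S k) k)"
  have "residue (S k) k = residue (S (Suc k)) (Suc k) mod 2 ^ k" for k
    using S[of k "Suc k"] residue_mod[of k "Suc k" "S (Suc k)"] by simp
  then have "(\<lambda>k. residue (S k) k) \<in> {f. \<forall>k. f k = f (Suc k) mod 2 ^ k}"
    by blast
  then have L: "residue L k = residue (S k) k" for k
    unfolding L_def by (subst Abs_two_adic_inverse) (assumption, rule refl)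
  have "S \<longlonglongrightarrow> L"
  proof (rule topological_tendstoI)
    fix U :: "two_adic set"
    assume "open U" "L \<in> U"
    then obtain k where "\<forall>y. residue y k = residue L k \<longrightarrow> y \<in> U"
      unfolding open_two_adic_def by blast
    then show "eventually (\<lambda>n. S n \<in> U) sequentially"
      unfolding eventually_sequentially using S L by metis
  qed
  then show ?thesis
    unfolding summable_def sums_def S_def by blast
qed

definition two_adic_units :: "two_adic monoid" where
  "two_adic_units = units_of \<lparr>carrier = UNIV, monoid.mult = (*), one = 1\<rparr>"


section \<open>The binary rooted tree and its automorphisms\<close>

datatype letter = La | Lb

type_synonym node = "letter list"

text \<open>The tree of height \<open>n\<close>, where \<open>n = \<infinity>\<close> is the infinite tree.\<close>

definition nodes :: "enat \<Rightarrow> node set" where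
  "nodes n = {w. enat (length w) \<le> n}"

definition adjacent :: "node \<Rightarrow> node \<Rightarrow> bool" where
  "adjacent u v \<longleftrightarrow> (\<exists>c. v = u @ [c] \<or> u = v @ [c])"

text \<open>
  As in \<^const>\<open>BijGroup\<close>, automorphisms are \<^const>\<open>undefined\<close> off the vertex set, and the
  product is composition.
\<close>

definition tree_aut :: "enat \<Rightarrow> (node \<Rightarrow> node) monoid" where
  "tree_aut n = (BijGroup (nodes n))
     \<lparr>carrier := {\<sigma> \<in> Bij (nodes n). \<sigma> [] = [] \<and>
        (\<forall>u\<in>nodes n. \<forall>v\<in>nodes n. adjacent (\<sigma> u) (\<sigma> v) \<longleftrightarrow> adjacent u v)}\<rparr>"

lemma group_tree_aut: "group (tree_aut n)"
proof -
  let ?V = "nodes n" and ?C = "carrier (tree_aut n)"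
  interpret B: group "BijGroup ?V" by (rule group_BijGroup)
  have root: "[] \<in> ?V" by (simp add: nodes_def zero_enat_def[symmetric])
  have C: "\<sigma> \<in> ?C \<longleftrightarrow> \<sigma> \<in> Bij ?V \<and> \<sigma> [] = [] \<and>
      (\<forall>u\<in>?V. \<forall>v\<in>?V. adjacent (\<sigma> u) (\<sigma> v) \<longleftrightarrow> adjacent u v)" for \<sigma>
    by (simp add: tree_aut_def)
  have "subgroup ?C (BijGroup ?V)"
  proof (rule B.subgroupI)
    show "?C \<subseteq> carrier (BijGroup ?V)"
      by (auto simp: C BijGroup_def)
    have "(\<lambda>x\<in>?V. x) \<in> ?C"
      using root by (auto simp: C id_Bij)
    then show "?C \<noteq> {}" by blast
  next
    fix \<sigma> assume s: "\<sigma> \<in> ?C"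
    then have bij: "bij_betw \<sigma> ?V ?V" and sB: "\<sigma> \<in> Bij ?V" by (auto simp: C Bij_def)
    let ?i = "\<lambda>x\<in>?V. inv_into ?V \<sigma> x"
    have i: "inv\<^bsub>BijGroup ?V\<^esub> \<sigma> = ?i"
      by (rule inv_BijGroup[OF sB])
    have mem: "inv_into ?V \<sigma> u \<in> ?V" and eq: "\<sigma> (inv_into ?V \<sigma> u) = u" if "u \<in> ?V" for u
      using that bij Bij_inv_into_mem[OF sB] by (auto simp: bij_betw_inv_into_right)
    have "inv_into ?V \<sigma> [] = []"
      using s root bij by (metis C bij_betw_inv_into_left)
    moreover have "adjacent (?i u) (?i v) \<longleftrightarrow> adjacent u v" if "u \<in> ?V" "v \<in> ?V" for u v
    proof -
      have "adjacent (\<sigma> (?i u)) (\<sigma> (?i v)) \<longleftrightarrow> adjacent (?i u) (?i v)"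
        using s that mem by (simp add: C)
      then show ?thesis using that eq by simp
    qed
    ultimately show "inv\<^bsub>BijGroup ?V\<^esub> \<sigma> \<in> ?C"
      unfolding i C using root restrict_inv_into_Bij[OF sB] by simp
  next
    fix \<sigma> \<tau> assume s: "\<sigma> \<in> ?C" and t: "\<tau> \<in> ?C"
    then have B: "\<sigma> \<in> Bij ?V" "\<tau> \<in> Bij ?V" by (auto simp: C)
    then have "\<tau> u \<in> ?V" if "u \<in> ?V" for u
      using that Bij_imp_funcset by blast
    then have "compose ?V \<sigma> \<tau> \<in> ?C"
      using s t root B unfolding C by (simp add: compose_Bij compose_eq)
    then show "\<sigma> \<otimes>\<^bsub>BijGroup ?V\<^esub> \<tau> \<in> ?C"
      using B by (simp add: BijGroup_def)
  qed
  from B.subgroup_imp_group[OF this] show ?thesis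
    by (simp add: tree_aut_def)
qed


section \<open>The maps Par, Q and P\<close>

text \<open>For an automorphism, the second branch is the case where the two children are swapped.\<close>

definition Par :: "(node \<Rightarrow> node) \<Rightarrow> node \<Rightarrow> nat" where
  "Par \<sigma> x = (if \<sigma> (x @ [La]) = \<sigma> x @ [La] \<and> \<sigma> (x @ [Lb]) = \<sigma> x @ [Lb] then 0 else 1)"

text \<open>The series converges by \<open>summable_two_adic\<close>.\<close>

definition Q :: "(node \<Rightarrow> node) \<Rightarrow> node \<Rightarrow> two_adic" where
  "Q \<sigma> x = (\<Sum>i. 2 ^ i *
     (\<Sum>s | length s = i. of_nat (Par \<sigma> (x @ concat (map (\<lambda>t. [La, t]) s)))))"

definition P :: "(node \<Rightarrow> node) \<Rightarrow> node \<Rightarrow> two_adic" where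
  "P \<sigma> x = (- 1) ^ Par \<sigma> x
     + 2 * (\<Sum>t\<in>{La, Lb}. Q \<sigma> (x @ [Lb, t]))
     - 2 * (\<Sum>t\<in>{La, Lb}. Q \<sigma> (x @ [La, t]))"

text \<open>
  For an automorphism \<open>\<tau>\<close> of the tree of height \<open>n\<close>: the common value, over all extensions
  \<open>\<sigma>\<close> of \<open>\<tau>\<close> to the infinite tree, of \<open>P \<sigma> x\<close> modulo 2^j, as an element of {0..<2^j}.
\<close>

definition Pfin :: "nat \<Rightarrow> (node \<Rightarrow> node) \<Rightarrow> node \<Rightarrow> int" where
  "Pfin n \<tau> x = (THE r. \<forall>\<sigma>\<in>carrier (tree_aut \<infinity>).
     (\<forall>w\<in>nodes (enat n). \<sigma> w = \<tau> w) \<longrightarrow> residue (P \<sigma> x) ((n - length x + 1) div 2) = r)"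

definition Minf :: "(node \<Rightarrow> node) set" where
  "Minf = {\<sigma> \<in> carrier (tree_aut \<infinity>). \<forall>x. P \<sigma> x = P \<sigma> []}"

text \<open>For nodes at levels beyond \<open>n\<close> the exponent would be nonpositive, so they impose no condition.\<close>

definition Mfin :: "nat \<Rightarrow> (node \<Rightarrow> node) set" where
  "Mfin n = {\<sigma> \<in> carrier (tree_aut (enat n)). \<forall>x\<in>nodes (enat n).
     [Pfin n \<sigma> x = Pfin n \<sigma> []] (mod 2 ^ ((n - length x + 1) div 2))}"

end

theory Submission
  imports Defs
begin

text \<open>
  The crucial point is a cocycle identity: if \<open>P \<sigma>\<close> is constant with value \<open>p\<close>, then
  \<open>Q (\<sigma> \<circ> \<tau>) x = Q \<sigma> (\<tau> x) + p * Q \<tau> x\<close> for every automorphism \<open>\<tau>\<close>. The difference \<open>D x\<close> of the two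
  sides satisfies \<open>D x = Par \<tau> x * (P \<sigma> (\<tau> x) - p) + 2 * (D (x a a) + D (x a b))\<close>, so it is
  divisible by every power of 2. Hence \<open>P (\<sigma> \<circ> \<tau>) x = p * P \<tau> x\<close>; taking \<open>\<tau> = \<sigma>\<inverse>\<close> shows that \<open>p\<close>
  is a unit and that \<open>P \<sigma>\<inverse>\<close> is constant.

  The same argument works when \<open>P \<sigma> x\<close> agrees with \<open>p\<close> only modulo \<open>2 ^ e m\<close>, \<open>m\<close> being the level
  of \<open>x\<close>, provided \<open>e m \<le> e (m + 2) + 1\<close>. The infinite tree is the case of all constant \<open>e\<close>, and the
  tree of height \<open>n\<close> the case \<open>e m = (n - m + 1) div 2\<close>, applied to extensions.
\<close>

section \<open>Congruences in the 2-adic integers\<close>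

lemma residue_0 [simp]: "residue z 0 = 0"
  using residue_mod[of 0 0 z] by simp

lemma two_adic_eqI: "(\<And>k. residue u k = residue v k) \<Longrightarrow> u = v"
  by (rule residue_inject[THEN iffD1]) (rule ext)

lemma residue_self_mod [simp]: "residue z k mod 2 ^ k = residue z k"
  by (rule residue_mod) simp

text \<open>Doubling gains one binary digit: \<open>u\<close> modulo 2^k already determines
  \<open>2 * u\<close> modulo 2^(k+1). Every induction on the number of digits below rests on
  this.\<close>

lemma residue_double: "residue (2 * u) (Suc k) = 2 * residue u k"
proof -
  have "residue (2 * u) (Suc k) = (2 * residue u (Suc k)) mod (2 * 2 ^ k)"
    by (simp only: mult_2 plus_two_adic.rep_eq power_Suc)
  also have "\<dots> = 2 * (residue u (Suc k) mod 2 ^ k)"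
    by (rule mult_mod_right[symmetric])
  finally show ?thesis by (simp add: residue_mod)
qed

lemma residue_diff_eq_0_iff: "residue (u - v) k = 0 \<longleftrightarrow> residue u k = residue v k"
proof
  assume "residue (u - v) k = 0"
  then have "residue u k mod 2 ^ k = residue v k mod 2 ^ k"
    by (simp only: minus_two_adic.rep_eq mod_eq_dvd_iff dvd_eq_mod_eq_0)
  then show "residue u k = residue v k" by simp
qed (simp add: minus_two_adic.rep_eq)

lemma residue_add_eq_0: "residue u k = 0 \<Longrightarrow> residue v k = 0 \<Longrightarrow> residue (u + v) k = 0"
  by (simp add: plus_two_adic.rep_eq)

lemma residue_mono_eq_0: "residue u l = 0 \<Longrightarrow> k \<le> l \<Longrightarrow> residue u k = 0"
  using residue_mod[of k l u] by simp

text \<open>Modulo 2^k the terms with index at least \<open>k\<close> vanish, so the partial sums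
  are stable from \<open>k\<close> on. Residue classes are open, so the limit has this stable
  residue. Identities between series thereby reduce to identities between finite sums.\<close>

lemma residue_suminf:
  "residue (\<Sum>i. 2 ^ i * c i) k = residue (\<Sum>i<k. 2 ^ i * c i) k"
proof -
  define S where "S n = (\<Sum>i<n. 2 ^ i * c i)" for n
  have pow: "residue (2 ^ i * c i) k = 0" if "k \<le> i" for i
  proof -
    have "residue (2 ^ i :: two_adic) k = 2 ^ i mod 2 ^ k"
      using residue_of_nat[of "2 ^ i" k] by simp
    then show ?thesis using that by (simp add: times_two_adic.rep_eq le_imp_power_dvd)
  qed
  have stable: "residue (S n) k = residue (S k) k" if "k \<le> n" for n
    using that by (induction n rule: dec_induct) (simp_all add: S_def plus_two_adic.rep_eq pow)
  have "S \<longlonglongrightarrow> (\<Sum>i. 2 ^ i * c i)"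
    unfolding S_def using summable_two_adic by (rule summable_LIMSEQ)
  moreover have "open {z. residue z k = residue (\<Sum>i. 2 ^ i * c i) k}"
    unfolding open_two_adic_def by (metis mem_Collect_eq)
  ultimately have "eventually (\<lambda>n. residue (S n) k = residue (\<Sum>i. 2 ^ i * c i) k) sequentially"
    by (auto dest: topological_tendstoD)
  then obtain N where "\<And>n. n \<ge> N \<Longrightarrow> residue (S n) k = residue (\<Sum>i. 2 ^ i * c i) k"
    by (auto simp: eventually_sequentially)
  from this[of "max N k"] stable[of "max N k"] show ?thesis
    by (simp add: S_def)
qed

lemma suminf_two_adic_split_head:
  "(\<Sum>i. 2 ^ i * c i) = c 0 + 2 * (\<Sum>i. 2 ^ i * c (Suc i) :: two_adic)"
proof (rule two_adic_eqI)
  fix k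
  have "(\<Sum>i<Suc k. 2 ^ i * c i) = c 0 + 2 * (\<Sum>i<k. 2 ^ i * c (Suc i))"
    by (simp add: sum.lessThan_Suc_shift sum_distrib_left mult.assoc del: sum.lessThan_Suc)
  \<comment> \<open>Working with \<open>Suc k\<close> digits matches the finite sums: after the
    factor 2 is removed, exactly \<open>k\<close> digits of the shifted series remain.\<close>
  then have "residue (\<Sum>i. 2 ^ i * c i) (Suc k)
      = residue (c 0 + 2 * (\<Sum>i<k. 2 ^ i * c (Suc i))) (Suc k)"
    by (simp only: residue_suminf)
  also have "\<dots> = residue (c 0 + 2 * (\<Sum>i. 2 ^ i * c (Suc i))) (Suc k)"
    by (simp only: plus_two_adic.rep_eq residue_double residue_suminf)
  finally show "residue (\<Sum>i. 2 ^ i * c i) k = residue (c 0 + 2 * (\<Sum>i. 2 ^ i * c (Suc i))) k"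
    by (rule residue_eq_mono) simp
qed

lemma monoid_two_adic: "monoid \<lparr>carrier = UNIV, monoid.mult = (*), one = (1 :: two_adic)\<rparr>"
  by unfold_locales (simp_all add: mult.assoc)

lemma in_two_adic_units: "u * v = 1 \<Longrightarrow> u \<in> carrier two_adic_units"
  by (auto simp: two_adic_units_def units_of_def Units_def mult.commute)

section \<open>Tree automorphisms\<close>

lemma Nil_in_nodes [simp]: "[] \<in> nodes N"
  by (simp add: nodes_def zero_enat_def[symmetric])

lemma nodes_infinity [simp]: "nodes \<infinity> = UNIV"
  by (simp add: nodes_def)

lemma nodes_prefix: "w @ v \<in> nodes N \<Longrightarrow> w \<in> nodes N"
  unfolding nodes_def by (auto intro: order_trans[rotated])

lemma tree_aut_mult:
  "\<lbrakk>\<sigma> \<in> carrier (tree_aut N); \<tau> \<in> carrier (tree_aut N)\<rbrakk>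
    \<Longrightarrow> \<sigma> \<otimes>\<^bsub>tree_aut N\<^esub> \<tau> = compose (nodes N) \<sigma> \<tau>"
  by (simp add: tree_aut_def BijGroup_def)

lemma tree_aut_one: "\<one>\<^bsub>tree_aut N\<^esub> = (\<lambda>w\<in>nodes N. w)"
  by (simp add: tree_aut_def BijGroup_def)

lemma tree_aut_bij: "\<sigma> \<in> carrier (tree_aut N) \<Longrightarrow> bij_betw \<sigma> (nodes N) (nodes N)"
  by (simp add: tree_aut_def Bij_def)

lemma tree_aut_Nil: "\<sigma> \<in> carrier (tree_aut N) \<Longrightarrow> \<sigma> [] = []"
  by (simp add: tree_aut_def)

lemma tree_aut_adjacent:
  "\<lbrakk>\<sigma> \<in> carrier (tree_aut N); u \<in> nodes N; v \<in> nodes N\<rbrakk> \<Longrightarrow> adjacent (\<sigma> u) (\<sigma> v) \<longleftrightarrow> adjacent u v"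
  by (simp add: tree_aut_def)

text \<open>The image of a child is adjacent to the image of its parent, so it lies directly below
  or directly above it. By induction the node directly above is the image of the grandparent, which
  injectivity excludes; at the root nothing lies above.\<close>

lemma tree_aut_child:
  assumes "\<sigma> \<in> carrier (tree_aut N)" "w @ [c] \<in> nodes N"
  shows "\<exists>c'. \<sigma> (w @ [c]) = \<sigma> w @ [c']"
  using assms(2)
proof (induction w arbitrary: c rule: rev_induct)
  case Nil
  then have "adjacent (\<sigma> []) (\<sigma> [c])"
    using tree_aut_adjacent[OF assms(1), of "[]" "[c]"] by (simp add: adjacent_def)
  then show ?case
    using tree_aut_Nil[OF assms(1)] by (auto simp: adjacent_def)
next
  case (snoc d v)
  have v: "v @ [d] \<in> nodes N" "v \<in> nodes N"
    using snoc.prems nodes_prefix by blast+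
  obtain d' where d': "\<sigma> (v @ [d]) = \<sigma> v @ [d']"
    using snoc.IH[OF v(1)] by blast
  have "adjacent (\<sigma> (v @ [d])) (\<sigma> ((v @ [d]) @ [c]))"
    using tree_aut_adjacent[OF assms(1) v(1) snoc.prems] by (auto simp: adjacent_def)
  moreover have "\<sigma> ((v @ [d]) @ [c]) \<noteq> \<sigma> v"
    using tree_aut_bij[OF assms(1)] snoc.prems v(2) by (auto simp: bij_betw_def dest: inj_onD)
  ultimately show ?case
    unfolding adjacent_def d' by auto
qed

lemma tree_aut_length:
  "\<lbrakk>\<sigma> \<in> carrier (tree_aut N); w \<in> nodes N\<rbrakk> \<Longrightarrow> length (\<sigma> w) = length w"
proof (induction w rule: rev_induct)
  case (snoc c w)
  then show ?case
    using tree_aut_child[of \<sigma> N w c] nodes_prefix[of w "[c]" N] by auto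
qed (simp add: tree_aut_Nil)

text \<open>Sending children to children preserves levels. Conversely, if \<open>\<sigma> v\<close>
  is a child of \<open>\<sigma> u\<close>, then \<open>v\<close> has a parent, whose image is
  \<open>\<sigma> u\<close>; by injectivity that parent is \<open>u\<close>.\<close>

lemma tree_aut_infinityI:
  assumes bij: "bij \<sigma>" and nil: "\<sigma> [] = []" and child: "\<And>w c. \<exists>c'. \<sigma> (w @ [c]) = \<sigma> w @ [c']"
  shows "\<sigma> \<in> carrier (tree_aut \<infinity>)"
proof -
  have len: "length (\<sigma> w) = length w" for w
  proof (induction w rule: rev_induct)
    case (snoc c w)
    then show ?case using child[of w c] by auto
  qed (simp add: nil)
  have parent: "\<exists>c. v = u @ [c]" if "\<sigma> v = \<sigma> u @ [d]" for u v d
  proof -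
    have "length v = Suc (length u)"
      using that len[of v] len[of u] by simp
    then obtain v' c where v: "v = v' @ [c]"
      by (metis Zero_not_Suc list.size(3) rev_exhaust)
    then have "\<sigma> v' = \<sigma> u"
      using that child[of v' c] by auto
    then show ?thesis using v bij by (auto simp: bij_def dest: injD)
  qed
  have "adjacent (\<sigma> u) (\<sigma> v) \<longleftrightarrow> adjacent u v" for u v
    unfolding adjacent_def using parent child by metis
  then show ?thesis
    using bij nil by (simp add: tree_aut_def Bij_def)
qed

section \<open>Extending automorphisms of a finite tree to the infinite tree\<close>

definition extends :: "nat \<Rightarrow> (node \<Rightarrow> node) \<Rightarrow> (node \<Rightarrow> node) \<Rightarrow> bool" where
  "extends n \<tau> \<sigma> \<longleftrightarrow> \<sigma> \<in> carrier (tree_aut \<infinity>) \<and> (\<forall>w\<in>nodes (enat n). \<sigma> w = \<tau> w)"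

text \<open>The extension applies \<open>\<tau>\<close> to the first \<open>n\<close> letters and
  keeps the others. Existence matters because \<open>Pfin\<close> is a definite description over all
  extensions, which singles out no value if there are none.\<close>

lemma ex_extends:
  assumes t: "\<tau> \<in> carrier (tree_aut (enat n))"
  shows "\<exists>\<sigma>. extends n \<tau> \<sigma>"
proof -
  define \<sigma> where "\<sigma> w = \<tau> (take n w) @ drop n w" for w
  have mem: "take n w \<in> nodes (enat n)" for w by (simp add: nodes_def)
  have len: "length (\<tau> (take n w)) = min n (length w)" for w
    using tree_aut_length[OF t mem[of w]] by (simp add: min.commute)
  have len_\<sigma>: "length (\<sigma> w) = length w" for w
    by (simp add: \<sigma>_def len)
  have inj_t: "u = v" if "\<tau> u = \<tau> v" "u \<in> nodes (enat n)" "v \<in> nodes (enat n)" for u v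
    using that tree_aut_bij[OF t] by (auto simp: bij_betw_def dest: inj_onD)
  have "inj \<sigma>"
  proof (rule injI)
    fix u v assume eq: "\<sigma> u = \<sigma> v"
    then have "length u = length v"
      using len_\<sigma> by metis
    then have "\<tau> (take n u) = \<tau> (take n v) \<and> drop n u = drop n v"
      using eq len[of u] len[of v] by (simp add: \<sigma>_def)
    then show "u = v"
      using inj_t mem append_take_drop_id by metis
  qed
  moreover have "\<exists>v. \<sigma> v = w" for w
  proof -
    obtain u where u: "u \<in> nodes (enat n)" "\<tau> u = take n w"
      using tree_aut_bij[OF t] mem[of w] by (auto simp: bij_betw_def image_iff dest!: equalityD2[THEN subsetD])
    then have "length u = min n (length w)"
      using tree_aut_length[OF t u(1)] by (simp add: min.commute)
    \<comment> \<open>Either \<open>drop n w\<close> is empty or \<open>u\<close> has length exactly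
      \<open>n\<close>; in both cases \<open>take n\<close> recovers \<open>u\<close> from the
      concatenation.\<close>
    then have "\<sigma> (u @ drop n w) = w"
      using u by (cases "length w \<le> n") (simp_all add: \<sigma>_def)
    then show ?thesis ..
  qed
  ultimately have "bij \<sigma>" by (metis bijI surjI)
  moreover have "\<sigma> [] = []" by (simp add: \<sigma>_def tree_aut_Nil[OF t])
  moreover have "\<exists>c'. \<sigma> (w @ [c]) = \<sigma> w @ [c']" for w c
  proof (cases "length w < n")
    case True
    then show ?thesis
      using tree_aut_child[OF t, of w c] by (simp add: \<sigma>_def nodes_def)
  qed (simp add: \<sigma>_def)
  ultimately have "\<sigma> \<in> carrier (tree_aut \<infinity>)"
    by (rule tree_aut_infinityI)
  then show ?thesis
    by (auto simp: extends_def \<sigma>_def nodes_def)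
qed

lemma comp_in_tree_aut:
  "\<lbrakk>\<sigma> \<in> carrier (tree_aut \<infinity>); \<tau> \<in> carrier (tree_aut \<infinity>)\<rbrakk> \<Longrightarrow> \<sigma> \<circ> \<tau> \<in> carrier (tree_aut \<infinity>)"
  using monoid.m_closed[OF group.is_monoid[OF group_tree_aut], of \<sigma> \<infinity> \<tau>]
  by (simp add: tree_aut_mult compose_def comp_def restrict_UNIV)

lemma tree_aut_infinity_mult:
  "\<lbrakk>\<sigma> \<in> carrier (tree_aut \<infinity>); \<tau> \<in> carrier (tree_aut \<infinity>)\<rbrakk>
    \<Longrightarrow> \<sigma> \<otimes>\<^bsub>tree_aut \<infinity>\<^esub> \<tau> = \<sigma> \<circ> \<tau>"
  by (simp add: tree_aut_mult compose_def comp_def restrict_UNIV)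

lemma tree_aut_infinity_one: "\<one>\<^bsub>tree_aut \<infinity>\<^esub> = id"
  by (simp add: tree_aut_one id_def restrict_UNIV)

lemma extends_compose:
  assumes "\<tau> \<in> carrier (tree_aut (enat n))" "extends n \<sigma> \<sigma>'" "extends n \<tau> \<tau>'"
  shows "extends n (compose (nodes (enat n)) \<sigma> \<tau>) (\<sigma>' \<circ> \<tau>')"
  using assms tree_aut_bij[OF assms(1)]
  by (auto simp: extends_def comp_in_tree_aut compose_def bij_betw_def)

section \<open>Parities as swaps of the two children\<close>

definition flip :: "nat \<Rightarrow> letter \<Rightarrow> letter" where
  "flip i c = (if i = 0 then c else if c = La then Lb else La)"

lemma flip_simps [simp]:
  "flip 0 c = c" "flip (Suc i) La = Lb" "flip (Suc i) Lb = La"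
  by (simp_all add: flip_def)

lemma Par_cases: "Par \<sigma> x = 0 \<or> Par \<sigma> x = 1"
  by (simp add: Par_def)

text \<open>Both children are sent to children of \<open>\<sigma> x\<close>, and to different ones
  by injectivity. This leaves only the two patterns that \<open>Par\<close> distinguishes.\<close>

lemma tree_aut_snoc:
  assumes "\<sigma> \<in> carrier (tree_aut \<infinity>)"
  shows "\<sigma> (x @ [c]) = \<sigma> x @ [flip (Par \<sigma> x) c]"
proof -
  obtain a b where ab: "\<sigma> (x @ [La]) = \<sigma> x @ [a]" "\<sigma> (x @ [Lb]) = \<sigma> x @ [b]"
    using tree_aut_child[OF assms] by (metis UNIV_I nodes_infinity)
  have "\<sigma> (x @ [La]) \<noteq> \<sigma> (x @ [Lb])"
    using tree_aut_bij[OF assms] by (auto simp: bij_betw_def dest: injD)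
  then show ?thesis
    using ab by (cases a; cases b; cases c) (auto simp: Par_def)
qed

text \<open>Parities add modulo 2, with the parity of \<open>\<sigma>\<close> read at the node where
  \<open>\<tau>\<close> has moved \<open>x\<close>.\<close>

lemma Par_comp:
  assumes "\<sigma> \<in> carrier (tree_aut \<infinity>)" "\<tau> \<in> carrier (tree_aut \<infinity>)"
  shows "Par (\<sigma> \<circ> \<tau>) x = (if Par \<sigma> (\<tau> x) = Par \<tau> x then 0 else 1)"
  using Par_cases[of \<sigma> "\<tau> x"] Par_cases[of \<tau> x]
  by (subst Par_def) (auto simp: tree_aut_snoc[OF assms(1)] tree_aut_snoc[OF assms(2)])

lemma sum_letter: "(\<Sum>t\<in>{La, Lb}. f t) = f La + (f Lb :: 'a :: comm_monoid_add)"
  by simp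

text \<open>Below the image of the child \<open>c\<close>, the automorphism may still swap the two
  grandchildren, but a sum over both does not see it. Only the parity at \<open>x\<close> itself
  matters.\<close>

lemma sum_grandchildren:
  fixes f :: "node \<Rightarrow> two_adic"
  assumes "\<tau> \<in> carrier (tree_aut \<infinity>)"
  shows "f (\<tau> (x @ [c, La])) + f (\<tau> (x @ [c, Lb]))
    = f (\<tau> x @ [flip (Par \<tau> x) c, La]) + f (\<tau> x @ [flip (Par \<tau> x) c, Lb])"
  using tree_aut_snoc[OF assms, of x c] tree_aut_snoc[OF assms, of "x @ [c]"] Par_cases[of \<tau> "x @ [c]"]
  by (auto simp: add.commute)

section \<open>The cocycle identity\<close>

lemma UNIV_letter: "(UNIV :: letter set) = {La, Lb}"
  using letter.exhaust by auto

lemma finite_words: "finite {s :: letter list. length s = i}"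
proof -
  have "finite (UNIV :: letter set)" by (simp add: UNIV_letter)
  from finite_lists_length_eq[OF this] show ?thesis by simp
qed

lemma sum_words_Suc:
  fixes f :: "node \<Rightarrow> 'a :: comm_monoid_add"
  shows "(\<Sum>s | length s = Suc i. f s) = (\<Sum>s | length s = i. f (La # s)) + (\<Sum>s | length s = i. f (Lb # s))"
proof -
  have "{s :: node. length s = Suc i} = (#) La ` {s. length s = i} \<union> (#) Lb ` {s. length s = i}"
    by (auto simp: length_Suc_conv image_iff) (metis letter.exhaust)
  moreover have "(#) La ` {s. length s = i} \<inter> (#) Lb ` {s. length s = i} = {}"
    by auto
  ultimately show ?thesis
    by (simp only: sum.union_disjoint finite_imageI finite_words) (simp add: sum.reindex)
qed

text \<open>The term of index 0 is the parity at \<open>x\<close>. In the others, sorting the words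
  by their first letter \<open>s\<close> leaves twice the series for the node reached from
  \<open>x\<close> by \<open>[La, s]\<close>.\<close>

lemma Q_rec:
  "Q \<sigma> x = of_nat (Par \<sigma> x) + 2 * (Q \<sigma> (x @ [La, La]) + Q \<sigma> (x @ [La, Lb]))"
proof -
  define c where "c y i = (\<Sum>s | length s = i.
    of_nat (Par \<sigma> (y @ concat (map (\<lambda>t. [La, t]) s))) :: two_adic)" for y i
  have Q: "Q \<sigma> y = (\<Sum>i. 2 ^ i * c y i)" for y by (simp add: Q_def c_def)
  have c0: "c x 0 = of_nat (Par \<sigma> x)" by (simp add: c_def)
  have cSuc: "c x (Suc i) = c (x @ [La, La]) i + c (x @ [La, Lb]) i" for i
    by (simp add: c_def sum_words_Suc)
  have "(\<Sum>i. 2 ^ i * c x (Suc i)) = Q \<sigma> (x @ [La, La]) + Q \<sigma> (x @ [La, Lb])"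
  proof (rule two_adic_eqI)
    fix k
    have "residue (\<Sum>i. 2 ^ i * c x (Suc i)) k = residue (\<Sum>i<k. 2 ^ i * c x (Suc i)) k"
      by (rule residue_suminf)
    also have "(\<Sum>i<k. 2 ^ i * c x (Suc i))
        = (\<Sum>i<k. 2 ^ i * c (x @ [La, La]) i) + (\<Sum>i<k. 2 ^ i * c (x @ [La, Lb]) i)"
      by (simp only: cSuc distrib_left sum.distrib)
    finally show "residue (\<Sum>i. 2 ^ i * c x (Suc i)) k
        = residue (Q \<sigma> (x @ [La, La]) + Q \<sigma> (x @ [La, Lb])) k"
      by (simp only: Q plus_two_adic.rep_eq residue_suminf)
  qed
  then show ?thesis
    unfolding Q[of x] suminf_two_adic_split_head[of "c x"] c0 by simp
qed

lemma P_eq: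
  "P \<sigma> x = (- 1) ^ Par \<sigma> x + 2 * (Q \<sigma> (x @ [Lb, La]) + Q \<sigma> (x @ [Lb, Lb]))
     - 2 * (Q \<sigma> (x @ [La, La]) + Q \<sigma> (x @ [La, Lb]))"
  by (simp add: P_def sum_letter)

section \<open>How many levels determine \<open>Q\<close> and \<open>P\<close> modulo a power of
  2\<close>

lemma Par_cong:
  assumes "\<And>w. length w \<le> Suc (length x) \<Longrightarrow> \<sigma> w = \<sigma>' w"
  shows "Par \<sigma> x = Par \<sigma>' x"
  using assms by (simp add: Par_def)

text \<open>By \<open>Q_rec\<close>, each further binary digit looks two levels deeper.\<close>

lemma residue_Q_cong:
  assumes "\<And>w. length w < length x + 2 * k \<Longrightarrow> \<sigma> w = \<sigma>' w"
  shows "residue (Q \<sigma> x) k = residue (Q \<sigma>' x) k"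
  using assms
proof (induction k arbitrary: x)
  case (Suc k)
  have "residue (Q \<sigma> (x @ [La, t])) k = residue (Q \<sigma>' (x @ [La, t])) k" for t
    by (rule Suc.IH) (simp add: Suc.prems)
  moreover have "Par \<sigma> x = Par \<sigma>' x"
    by (rule Par_cong) (simp add: Suc.prems)
  ultimately show ?case
    by (simp add: Q_rec[of _ x] plus_two_adic.rep_eq residue_double)
qed simp

text \<open>The \<open>Q\<close> terms in \<open>P\<close> start two levels below \<open>x\<close>
  but are doubled, so one digit less is needed from them and the depth bound is that of
  \<open>residue_Q_cong\<close>.\<close>

lemma residue_P_cong:
  assumes "\<And>w. length w < length x + 2 * k \<Longrightarrow> \<sigma> w = \<sigma>' w"
  shows "residue (P \<sigma> x) k = residue (P \<sigma>' x) k"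
proof (cases k)
  case (Suc l)
  have "residue (Q \<sigma> (x @ [s, t])) l = residue (Q \<sigma>' (x @ [s, t])) l" for s t
    by (rule residue_Q_cong) (simp add: assms Suc)
  moreover have "Par \<sigma> x = Par \<sigma>' x"
    by (rule Par_cong) (simp add: assms Suc)
  ultimately show ?thesis
    by (simp add: P_eq Suc plus_two_adic.rep_eq minus_two_adic.rep_eq residue_double)
qed simp


section \<open>The defect of the cocycle identity\<close>

definition defect :: "(node \<Rightarrow> node) \<Rightarrow> (node \<Rightarrow> node) \<Rightarrow> two_adic \<Rightarrow> node \<Rightarrow> two_adic" where
  "defect \<sigma> \<tau> p x = Q (\<sigma> \<circ> \<tau>) x - (Q \<sigma> (\<tau> x) + p * Q \<tau> x)"

text \<open>If \<open>\<tau>\<close> does not swap at \<open>x\<close>, the parities and the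
  \<open>La\<close> branches match up to a carry: when both parities are 0 or just one is 1 the
  bookkeeping is that of \<open>P\<close>.\<close>

lemma defect_rec:
  assumes s: "\<sigma> \<in> carrier (tree_aut \<infinity>)" and t: "\<tau> \<in> carrier (tree_aut \<infinity>)"
  shows "defect \<sigma> \<tau> p x = of_nat (Par \<tau> x) * (P \<sigma> (\<tau> x) - p)
     + 2 * (defect \<sigma> \<tau> p (x @ [La, La]) + defect \<sigma> \<tau> p (x @ [La, Lb]))"
proof -
  \<comment> \<open>The identity for the grandchildren is solved for one summand; after rewriting,
    the other value \<open>Q \<sigma> (\<tau> (x @ [La, Lb]))\<close> cancels.\<close>
  have a: "Q \<sigma> (\<tau> (x @ [La, La])) = Q \<sigma> (\<tau> x @ [flip (Par \<tau> x) La, La])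
      + Q \<sigma> (\<tau> x @ [flip (Par \<tau> x) La, Lb]) - Q \<sigma> (\<tau> (x @ [La, Lb]))"
    using sum_grandchildren[OF t, of "Q \<sigma>" x La] by (simp add: eq_diff_eq)
  show ?thesis
    unfolding defect_def a Q_rec[of _ x] Q_rec[of _ "\<tau> x"] P_eq Par_comp[OF s t]
    using Par_cases[of \<sigma> "\<tau> x"] Par_cases[of \<tau> x]
    by (elim disjE) (simp_all add: algebra_simps)
qed

text \<open>A swap of \<open>\<tau>\<close> at \<open>x\<close> reverses the sign of the parity term
  of \<open>\<sigma>\<close> and also exchanges its two branches, so all of
  \<open>P \<sigma> (\<tau> x)\<close> enters with the sign
  \<open>(- 1) ^ Par \<tau> x\<close>.\<close>

lemma P_comp_defect:
  assumes s: "\<sigma> \<in> carrier (tree_aut \<infinity>)" and t: "\<tau> \<in> carrier (tree_aut \<infinity>)"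
  shows "P (\<sigma> \<circ> \<tau>) x - p * P \<tau> x = (- 1) ^ Par \<tau> x * (P \<sigma> (\<tau> x) - p)
     + 2 * (defect \<sigma> \<tau> p (x @ [Lb, La]) + defect \<sigma> \<tau> p (x @ [Lb, Lb])
          - (defect \<sigma> \<tau> p (x @ [La, La]) + defect \<sigma> \<tau> p (x @ [La, Lb])))"
proof -
  have a: "Q \<sigma> (\<tau> (x @ [c, La])) = Q \<sigma> (\<tau> x @ [flip (Par \<tau> x) c, La])
      + Q \<sigma> (\<tau> x @ [flip (Par \<tau> x) c, Lb]) - Q \<sigma> (\<tau> (x @ [c, Lb]))" for c
    using sum_grandchildren[OF t, of "Q \<sigma>" x c] by (simp add: eq_diff_eq)
  show ?thesis
    unfolding defect_def a P_eq Par_comp[OF s t]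
    using Par_cases[of \<sigma> "\<tau> x"] Par_cases[of \<tau> x]
    by (elim disjE) (simp_all add: algebra_simps)
qed

text \<open>Here \<open>e m\<close> is the number of digits available at level \<open>m\<close>.
  Since \<open>\<tau>\<close> preserves levels, \<open>P \<sigma> (\<tau> x)\<close> is known to the
  precision of \<open>x\<close>; the factor 2 in both defect formulas pays for the one digit that
  may be lost two levels down.\<close>

lemma residue_P_comp:
  assumes s: "\<sigma> \<in> carrier (tree_aut \<infinity>)" and t: "\<tau> \<in> carrier (tree_aut \<infinity>)"
    and e: "\<And>m. e m \<le> Suc (e (Suc (Suc m)))"
    and p: "\<And>x. residue (P \<sigma> x) (e (length x)) = residue p (e (length x))"
  shows "residue (P (\<sigma> \<circ> \<tau>) x) (e (length x)) = residue (p * P \<tau> x) (e (length x))"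
proof -
  have diff: "residue (c * (P \<sigma> (\<tau> x) - p)) (e (length x)) = 0" for c x
  proof -
    have "residue (P \<sigma> (\<tau> x) - p) (e (length x)) = 0"
      using p[of "\<tau> x"] tree_aut_length[OF t, of x] by (simp add: residue_diff_eq_0_iff)
    then show ?thesis by (simp add: times_two_adic.rep_eq)
  qed
  \<comment> \<open>The bound on \<open>k\<close> varies with \<open>x\<close>: passing from
    \<open>Suc k\<close> digits at \<open>x\<close> to \<open>k\<close> digits two levels below
    stays within it by the assumption on \<open>e\<close>.\<close>
  have defect: "residue (defect \<sigma> \<tau> p x) k = 0" if "k \<le> e (length x)" for k x
    using that
  proof (induction k arbitrary: x)
    case (Suc k)
    have "residue (defect \<sigma> \<tau> p (x @ [La, t])) k = 0" for t
      using Suc.prems e[of "length x"] by (intro Suc.IH) simp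
    then show ?case
      unfolding defect_rec[OF s t, of p x]
      by (intro residue_add_eq_0 residue_mono_eq_0[OF diff Suc.prems])
        (simp add: residue_double residue_add_eq_0)
  qed simp
  have "residue (P (\<sigma> \<circ> \<tau>) x - p * P \<tau> x) (e (length x)) = 0"
  proof (cases "e (length x)")
    case (Suc k)
    have "residue (defect \<sigma> \<tau> p (x @ [c, d])) k = 0" for c d
      using Suc e[of "length x"] by (intro defect) simp
    then show ?thesis
      unfolding P_comp_defect[OF s t] Suc using diff[of _ x]
      by (intro residue_add_eq_0)
        (simp_all add: Suc residue_double residue_diff_eq_0_iff residue_add_eq_0)
  qed simp
  then show ?thesis by (simp add: residue_diff_eq_0_iff)
qed

lemma P_id: "P id x = 1"
proof -
  have "Par id y = 0" for y by (simp add: Par_def)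
  then have "Q id y = 0" for y by (simp add: Q_def)
  then show ?thesis by (simp add: P_eq \<open>Par id x = 0\<close>)
qed

text \<open>Modulo 2^k the product \<open>q * p * y\<close> equals both \<open>q\<close> and
  \<open>y\<close>.\<close>

lemma residue_inverse_unique:
  assumes "residue (p * y) k = residue 1 k" "residue (p * q) k = residue 1 k"
  shows "residue y k = residue q k"
proof -
  have "residue (q * (p * y)) k = residue (q * 1) k" "residue (y * (p * q)) k = residue (y * 1) k"
    using assms by (simp_all only: times_two_adic.rep_eq[of q] times_two_adic.rep_eq[of y])
  then show ?thesis by (simp add: ac_simps)
qed

section \<open>The infinite tree\<close>

lemma P_comp:
  assumes s: "\<sigma> \<in> Minf" and t: "\<tau> \<in> carrier (tree_aut \<infinity>)"
  shows "P (\<sigma> \<circ> \<tau>) x = P \<sigma> [] * P \<tau> x"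
proof (rule two_adic_eqI)
  fix k
  have s': "\<sigma> \<in> carrier (tree_aut \<infinity>)" and P: "P \<sigma> y = P \<sigma> []" for y
    using s by (auto simp: Minf_def)
  have "residue (P \<sigma> y) k = residue (P \<sigma> []) k" for y
    by (simp only: P[of y])
  then show "residue (P (\<sigma> \<circ> \<tau>) x) k = residue (P \<sigma> [] * P \<tau> x) k"
    \<comment> \<open>A constant \<open>e\<close> loses no digits with depth, so each
      \<open>k\<close> can be treated separately.\<close>
    by (intro residue_P_comp[OF s' t, where e = "\<lambda>_. k"]) simp_all
qed

text \<open>\<open>P_comp\<close> asks only that its second factor be an automorphism, so it applies
  to the inverse before that is known to lie in \<open>Minf\<close>.\<close>

lemma P_inverse:
  assumes s: "\<sigma> \<in> Minf"
  shows "P \<sigma> [] * P (inv\<^bsub>tree_aut \<infinity>\<^esub> \<sigma>) x = 1"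
proof -
  interpret A: group "tree_aut \<infinity>" by (rule group_tree_aut)
  have s': "\<sigma> \<in> carrier (tree_aut \<infinity>)" using s by (simp add: Minf_def)
  have "\<sigma> \<circ> inv\<^bsub>tree_aut \<infinity>\<^esub> \<sigma> = id"
    using A.r_inv[OF s'] s' by (simp add: tree_aut_infinity_mult tree_aut_infinity_one)
  then show ?thesis
    using P_comp[OF s, of "inv\<^bsub>tree_aut \<infinity>\<^esub> \<sigma>" x] s' by (simp add: P_id)
qed

lemma subgroup_Minf: "subgroup Minf (tree_aut \<infinity>)"
proof -
  interpret A: group "tree_aut \<infinity>" by (rule group_tree_aut)
  show ?thesis
  proof (rule A.subgroupI)
    show sub: "Minf \<subseteq> carrier (tree_aut \<infinity>)" by (auto simp: Minf_def)
    have "id \<in> Minf"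
      using A.one_closed by (simp add: Minf_def P_id tree_aut_infinity_one)
    then show "Minf \<noteq> {}" by blast
    show "inv\<^bsub>tree_aut \<infinity>\<^esub> \<sigma> \<in> Minf" if s: "\<sigma> \<in> Minf" for \<sigma>
    proof -
      have "P (inv\<^bsub>tree_aut \<infinity>\<^esub> \<sigma>) x = P (inv\<^bsub>tree_aut \<infinity>\<^esub> \<sigma>) []" for x
        by (rule two_adic_eqI, rule residue_inverse_unique[of "P \<sigma> []"])
          (simp_all add: P_inverse[OF s])
      then show ?thesis using s sub by (auto simp: Minf_def)
    qed
    show "\<sigma> \<otimes>\<^bsub>tree_aut \<infinity>\<^esub> \<tau> \<in> Minf" if s: "\<sigma> \<in> Minf" and t: "\<tau> \<in> Minf" for \<sigma> \<tau>
    proof -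
      have st: "\<sigma> \<in> carrier (tree_aut \<infinity>)" "\<tau> \<in> carrier (tree_aut \<infinity>)"
        using s t by (auto simp: Minf_def)
      have "P (\<sigma> \<circ> \<tau>) x = P (\<sigma> \<circ> \<tau>) []" for x
      proof -
        have "P \<tau> x = P \<tau> []" using t by (auto simp: Minf_def)
        then show ?thesis by (simp only: P_comp[OF s st(2)])
      qed
      then show ?thesis
        by (auto simp: Minf_def tree_aut_infinity_mult comp_in_tree_aut st)
    qed
  qed
qed

lemma group_hom_P: "group_hom ((tree_aut \<infinity>)\<lparr>carrier := Minf\<rparr>) two_adic_units (\<lambda>\<sigma>. P \<sigma> [])"
proof -
  have "P \<sigma> [] \<in> carrier two_adic_units" if "\<sigma> \<in> Minf" for \<sigma>
    using P_inverse[OF that] by (rule in_two_adic_units)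
  moreover have "P (\<sigma> \<otimes>\<^bsub>tree_aut \<infinity>\<^esub> \<tau>) [] = P \<sigma> [] \<otimes>\<^bsub>two_adic_units\<^esub> P \<tau> []"
    if "\<sigma> \<in> Minf" "\<tau> \<in> Minf" for \<sigma> \<tau>
  proof -
    have "\<sigma> \<in> carrier (tree_aut \<infinity>)" "\<tau> \<in> carrier (tree_aut \<infinity>)"
      using that by (auto simp: Minf_def)
    then show ?thesis
      using P_comp[OF that(1)]
      by (simp add: tree_aut_infinity_mult two_adic_units_def units_of_def)
  qed
  ultimately show ?thesis
    using subgroup.subgroup_is_group[OF subgroup_Minf group_tree_aut]
      monoid.units_group[OF monoid_two_adic]
    by (simp add: group_hom_def group_hom_axioms_def hom_def two_adic_units_def[symmetric])
qed

section \<open>The finite trees\<close>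

abbreviation expo :: "nat \<Rightarrow> node \<Rightarrow> nat" where
  "expo n x \<equiv> (n - length x + 1) div 2"

text \<open>Two extensions agree up to level \<open>n\<close>, and \<open>expo n x\<close> digits of
  \<open>P\<close> at \<open>x\<close> depend on no deeper level.\<close>

lemma Pfin_eq:
  assumes "extends n \<tau> \<sigma>"
  shows "Pfin n \<tau> x = residue (P \<sigma> x) (expo n x)"
  unfolding Pfin_def
proof (rule the_equality)
  show "\<forall>\<sigma>'\<in>carrier (tree_aut \<infinity>). (\<forall>w\<in>nodes (enat n). \<sigma>' w = \<tau> w) \<longrightarrow>
    residue (P \<sigma>' x) (expo n x) = residue (P \<sigma> x) (expo n x)"
  proof (intro ballI impI)
    fix \<sigma>' assume "\<forall>w\<in>nodes (enat n). \<sigma>' w = \<tau> w"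
    then have eq: "\<sigma>' w = \<sigma> w" if "length w \<le> n" for w
      using that assms by (simp add: extends_def nodes_def)
    show "residue (P \<sigma>' x) (expo n x) = residue (P \<sigma> x) (expo n x)"
    \<comment> \<open>From level \<open>n\<close> on the exponent is 0 and all residues are 0; above
      it the subtraction is not truncated and twice the exponent is at most
      \<open>n - length x + 1\<close>.\<close>
    proof (cases "length x < n")
      case True
      then have "length w \<le> n" if "length w < length x + 2 * expo n x" for w :: node
        using that by linarith
      then show ?thesis by (intro residue_P_cong eq)
    qed simp
  qed
qed (use assms in \<open>auto simp: extends_def\<close>)

text \<open>The value at the root carries more digits than the one at \<open>x\<close> and is
  reduced to the precision of \<open>x\<close>. Beyond level \<open>n\<close> the exponent is 0, so
  the condition can be stated for all nodes.\<close>

lemma Mfin_iff: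
  assumes t: "\<tau> \<in> carrier (tree_aut (enat n))" and ext: "extends n \<tau> \<sigma>"
  shows "\<tau> \<in> Mfin n \<longleftrightarrow> (\<forall>x. residue (P \<sigma> x) (expo n x) = residue (P \<sigma> []) (expo n x))"
proof -
  have "[Pfin n \<tau> x = Pfin n \<tau> []] (mod 2 ^ expo n x)
    \<longleftrightarrow> residue (P \<sigma> x) (expo n x) = residue (P \<sigma> []) (expo n x)" for x
    using residue_mod[of "expo n x" "expo n []" "P \<sigma> []"]
    by (simp add: cong_def Pfin_eq[OF ext] div_le_mono)
  moreover have "residue (P \<sigma> x) (expo n x) = residue (P \<sigma> []) (expo n x)"
    if "x \<notin> nodes (enat n)" for x
    using that by (simp add: nodes_def)
  ultimately show ?thesis
    using t unfolding Mfin_def by blast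
qed

lemma Pfin_mult:
  assumes s: "\<sigma> \<in> Mfin n" and t: "\<tau> \<in> carrier (tree_aut (enat n))"
    and es: "extends n \<sigma> \<sigma>'" and et: "extends n \<tau> \<tau>'"
  shows "Pfin n (\<sigma> \<otimes>\<^bsub>tree_aut (enat n)\<^esub> \<tau>) x = residue (P \<sigma>' [] * P \<tau>' x) (expo n x)"
proof -
  have s': "\<sigma> \<in> carrier (tree_aut (enat n))" using s by (simp add: Mfin_def)
  have "Pfin n (\<sigma> \<otimes>\<^bsub>tree_aut (enat n)\<^esub> \<tau>) x = residue (P (\<sigma>' \<circ> \<tau>') x) (expo n x)"
    using Pfin_eq[OF extends_compose[OF t es et]] s' t by (simp add: tree_aut_mult)
  also have "\<dots> = residue (P \<sigma>' [] * P \<tau>' x) (expo n x)"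
    using es et s Mfin_iff[OF s' es]
    \<comment> \<open>Two levels down, the exponent drops by at most one, also where the subtraction
      is truncated.\<close>
    by (intro residue_P_comp[where e = "\<lambda>m. (n - m + 1) div 2"]) (auto simp: extends_def)
  finally show ?thesis .
qed

lemma Pfin_one: "Pfin n \<one>\<^bsub>tree_aut (enat n)\<^esub> x = residue 1 (expo n x)"
proof -
  have "extends n \<one>\<^bsub>tree_aut (enat n)\<^esub> id"
    using group.is_monoid[OF group_tree_aut, THEN monoid.one_closed, of \<infinity>]
    unfolding tree_aut_infinity_one by (simp add: extends_def tree_aut_one)
  then show ?thesis by (simp add: Pfin_eq P_id)
qed

text \<open>The two extensions are chosen independently, so their composition is known to be the
  identity only up to level \<open>n\<close>; this gives a congruence in place of an
  equality.\<close>

lemma Pfin_inverse: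
  assumes s: "\<sigma> \<in> Mfin n" and es: "extends n \<sigma> \<sigma>'"
    and et: "extends n (inv\<^bsub>tree_aut (enat n)\<^esub> \<sigma>) \<tau>'"
  shows "residue (P \<sigma>' [] * P \<tau>' x) (expo n x) = residue 1 (expo n x)"
proof -
  interpret A: group "tree_aut (enat n)" by (rule group_tree_aut)
  have s': "\<sigma> \<in> carrier (tree_aut (enat n))" using s by (simp add: Mfin_def)
  show ?thesis
    using Pfin_mult[OF s A.inv_closed[OF s'] es et, of x] s' by (simp add: Pfin_one)
qed

lemma subgroup_Mfin: "subgroup (Mfin n) (tree_aut (enat n))"
proof -
  interpret A: group "tree_aut (enat n)" by (rule group_tree_aut)
  have le: "expo n x \<le> expo n []" for x by (simp add: div_le_mono)
  show ?thesis
  proof (rule A.subgroupI)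
    show sub: "Mfin n \<subseteq> carrier (tree_aut (enat n))" by (auto simp: Mfin_def)
    have "[residue 1 (expo n x) = residue 1 (expo n [])] (mod 2 ^ expo n x)" for x
      using residue_mod[OF le, of 1 x] by (simp add: cong_def)
    then have "\<one>\<^bsub>tree_aut (enat n)\<^esub> \<in> Mfin n"
      unfolding Mfin_def mem_Collect_eq Pfin_one by blast
    then show "Mfin n \<noteq> {}" by blast
    show "inv\<^bsub>tree_aut (enat n)\<^esub> \<sigma> \<in> Mfin n" if s: "\<sigma> \<in> Mfin n" for \<sigma>
    proof -
      have i: "inv\<^bsub>tree_aut (enat n)\<^esub> \<sigma> \<in> carrier (tree_aut (enat n))" using s sub by auto
      obtain \<sigma>' \<tau>' where es: "extends n \<sigma> \<sigma>'" and et: "extends n (inv\<^bsub>tree_aut (enat n)\<^esub> \<sigma>) \<tau>'"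
        using ex_extends s sub i by blast
      show ?thesis
        unfolding Mfin_iff[OF i et]
      proof
        fix x
        show "residue (P \<tau>' x) (expo n x) = residue (P \<tau>' []) (expo n x)"
          \<comment> \<open>Both values invert \<open>P \<sigma>' []\<close> modulo the power of 2
            belonging to \<open>x\<close>; the congruence at the root holds to a higher precision
            and is lowered to that one.\<close>
          by (rule residue_inverse_unique[OF Pfin_inverse[OF s es et]])
            (rule residue_eq_mono[OF Pfin_inverse[OF s es et] le])
      qed
    qed
    show "\<sigma> \<otimes>\<^bsub>tree_aut (enat n)\<^esub> \<tau> \<in> Mfin n" if s: "\<sigma> \<in> Mfin n" and t: "\<tau> \<in> Mfin n" for \<sigma> \<tau>
    proof -
      have t': "\<tau> \<in> carrier (tree_aut (enat n))" using t sub by auto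
      obtain \<sigma>' \<tau>' where es: "extends n \<sigma> \<sigma>'" and et: "extends n \<tau> \<tau>'"
        using ex_extends s t sub by blast
      have "[Pfin n (\<sigma> \<otimes>\<^bsub>tree_aut (enat n)\<^esub> \<tau>) x = Pfin n (\<sigma> \<otimes>\<^bsub>tree_aut (enat n)\<^esub> \<tau>) []] (mod 2 ^ expo n x)" for x
      proof -
        have "residue (P \<tau>' x) (expo n x) = residue (P \<tau>' []) (expo n x)"
          using t Mfin_iff[OF t' et] by simp
        then have "residue (P \<sigma>' [] * P \<tau>' x) (expo n x) = residue (P \<sigma>' [] * P \<tau>' []) (expo n x)"
          by (simp only: times_two_adic.rep_eq)
        then show ?thesis
          unfolding cong_def Pfin_mult[OF s t' es et] residue_mod[OF le] by simp
      qed
      then show ?thesis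
        using s t' sub by (auto simp: Mfin_def)
    qed
  qed
qed

lemma group_hom_Pfin:
  assumes "n \<ge> 1"
  shows "group_hom ((tree_aut (enat n))\<lparr>carrier := Mfin n\<rparr>)
    (units_of (residue_ring (2 ^ ((n + 1) div 2)))) (\<lambda>\<sigma>. Pfin n \<sigma> [])"
proof -
  define j where "j = (n + 1) div 2"
  have j: "expo n [] = j" "j > 0" using assms by (simp_all add: j_def)
  then have one: "(1 :: int) < 2 ^ j" by (simp add: one_less_power)
  interpret A: group "tree_aut (enat n)" by (rule group_tree_aut)
  \<comment> \<open>The locale requires a modulus greater than 1, which is where
    \<open>n \<ge> 1\<close> enters.\<close>
  interpret R: residues "2 ^ j" "residue_ring (2 ^ j)"
    using j(2) by unfold_locales simp
  have sub: "\<sigma> \<in> carrier (tree_aut (enat n))" if "\<sigma> \<in> Mfin n" for \<sigma>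
    using that by (simp add: Mfin_def)
  have carrier: "residue z j \<in> carrier (residue_ring (2 ^ j))" for z
    \<comment> \<open>Writing the residue as its own reduction modulo \<open>2 ^ j\<close> makes its
      range visible.\<close>
    by (subst residue_self_mod[symmetric]) (simp add: R.res_carrier_eq del: residue_self_mod)
  have mult: "residue u j \<otimes>\<^bsub>residue_ring (2 ^ j)\<^esub> residue v j = residue (u * v) j" for u v
    by (simp add: R.res_mult_eq times_two_adic.rep_eq)
  have unit: "Pfin n \<sigma> [] \<in> Units (residue_ring (2 ^ j))" if s: "\<sigma> \<in> Mfin n" for \<sigma>
  proof -
    obtain \<sigma>' \<tau>' where es: "extends n \<sigma> \<sigma>'" and et: "extends n (inv\<^bsub>tree_aut (enat n)\<^esub> \<sigma>) \<tau>'"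
      using ex_extends[OF sub[OF s]] ex_extends[OF A.inv_closed[OF sub[OF s]]] by (elim exE)
    have "residue (P \<sigma>' [] * P \<tau>' []) j = residue 1 j"
      using Pfin_inverse[OF s es et, of "[]"] unfolding j .
    also have "\<dots> = \<one>\<^bsub>residue_ring (2 ^ j)\<^esub>"
      using j(2) by (simp add: one_two_adic.rep_eq R.res_one_eq)
    finally have inv: "residue (P \<sigma>' [] * P \<tau>' []) j = \<one>\<^bsub>residue_ring (2 ^ j)\<^esub>" .
    then have "residue (P \<sigma>' []) j \<in> Units (residue_ring (2 ^ j))"
      using carrier mult[of "P \<sigma>' []" "P \<tau>' []"] mult[of "P \<tau>' []" "P \<sigma>' []"]
      unfolding Units_def mult.commute[of "P \<tau>' []" "P \<sigma>' []"] by auto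
    then show ?thesis by (simp only: Pfin_eq[OF es] j)
  qed
  have "Pfin n (\<sigma> \<otimes>\<^bsub>tree_aut (enat n)\<^esub> \<tau>) [] = Pfin n \<sigma> [] \<otimes>\<^bsub>residue_ring (2 ^ j)\<^esub> Pfin n \<tau> []"
    if s: "\<sigma> \<in> Mfin n" and t: "\<tau> \<in> Mfin n" for \<sigma> \<tau>
  proof -
    obtain \<sigma>' \<tau>' where es: "extends n \<sigma> \<sigma>'" and et: "extends n \<tau> \<tau>'"
      using ex_extends[OF sub[OF s]] ex_extends[OF sub[OF t]] by (elim exE)
    show ?thesis
      by (simp only: Pfin_mult[OF s sub[OF t] es et] Pfin_eq[OF es] Pfin_eq[OF et] j mult)
  qed
  with unit show ?thesis
    using subgroup.subgroup_is_group[OF subgroup_Mfin group_tree_aut] R.units_group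
    unfolding j_def[symmetric]
    by (auto simp: group_hom_def group_hom_axioms_def hom_def units_of_carrier units_of_mult)
qed

theorem theorem3p2:
  shows "subgroup Minf (tree_aut \<infinity>)
    \<and> (\<forall>n::nat. n \<ge> 1 \<longrightarrow> subgroup (Mfin n) (tree_aut (enat n)))
    \<and> group_hom ((tree_aut \<infinity>)\<lparr>carrier := Minf\<rparr>) two_adic_units (\<lambda>\<sigma>. P \<sigma> [])
    \<and> (\<forall>n::nat. n \<ge> 1 \<longrightarrow>
        group_hom ((tree_aut (enat n))\<lparr>carrier := Mfin n\<rparr>)
          (units_of (residue_ring (2 ^ ((n + 1) div 2)))) (\<lambda>\<sigma>. Pfin n \<sigma> []))"
  using subgroup_Minf subgroup_Mfin group_hom_P group_hom_Pfin by blast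

end
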